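(* For integers $n,\Delta^*\in\mathbb{N}$ with $0\le\Delta^*<n$, there exists a bridgeless mixed graph $G$ with $n$ vertices and maximum undirected degree $\max\{d_G^*(v):v\in V(G)\}=\Delta^*$ that has a vertex $u$ satisfying $d_G^*(u)=\Delta^*$ and $d_G^+(u)+d_G^-(u)=0$, and whose oriented diameter satisfies $\overrightarrow{\mathrm{diam}}(G)\ge\min\{n-1,\;n-\Delta^*+4\}$.
   Context: A mixed graph $G$ is a pair $(V(G),E(G))$ where $V(G)$ is the vertex set and $E(G)$ may include both undirected edges $xy$ and directed edges $\overrightarrow{xy}$ (either kind may be absent); its underlying graph is assumed simple. For a vertex $x$: $d_G^+(x)$ is the number of directed edges leaving $x$, $d_G^-(x)$ the number of directed edges entering $x$, and $d_G^*(x)$ the number of undirected edges incident with $x$. An orientable path from $x_1$ to $x_k$ is a sequence of distinct vertices $x_1,\dots,x_k$ such that for each $1\le i\le k-1$ either $x_ix_{i+1}$ is an undirected edge or $\overrightarrow{x_ix_{i+1}}$ is a directed edge of $G$. A mixed graph $G$ is connected if for any two vertices $x,y$ there are an orientable path from $x$ to $y$ and an orientable path from $y$ to $x$. A bridge in $G$ is an undirected edge $e$ such that the mixed graph $G-e$ is disconnected (i.e. not connected in this sense). $G$ is bridgeless if it is connected and has no bridge. An orientation of $G$ assigns a direction to every undirected edge (directed edges keep their direction); it is strong if the resulting directed graph is strongly connected. The distance from $x$ to $y$ in a directed graph is the number of edges of a shortest directed path from $x$ to $y$, and the diameter is the maximum of these distances over all ordered pairs of vertices. The oriented diameter is $\overrightarrow{\mathrm{diam}}(G)=\min\{\mathrm{diam}(\overrightarrow{G}):\overrightarrow{G}\text{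 is a strong orientation of }G\}$.
   Formalization: The cases n ≥ 2 with Δ* ≤ 1 are excluded because the claim is false there: u would be isolated (Δ* = 0) or its only edge would be a bridge (Δ* = 1); the theorem is proved for n = 1 or Δ* ≥ 2. *)

theory Defs
  imports "Graph_Theory.Graph_Theory"
begin

text \<open>An undirected edge \<open>xy\<close> is the set \<open>{x, y}\<close>, a directed edge from \<open>x\<close> to \<open>y\<close>
  is the pair \<open>(x, y)\<close>.\<close>

record 'a mixed_graph =
  mverts :: "'a set"
  medges :: "'a set set"
  marcs :: "('a \<times> 'a) set"

text \<open>The last three conditions say that the underlying graph is simple: there are no loops,
  no two opposite directed edges, and no directed edge parallel to an undirected one.\<close>

definition mixed_graph :: "'a mixed_graph \<Rightarrow> bool" where
  "mixed_graph G \<longleftrightarrow>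
     finite (mverts G) \<and>
     (\<forall>e\<in>medges G. e \<subseteq> mverts G \<and> card e = 2) \<and>
     marcs G \<subseteq> mverts G \<times> mverts G \<and>
     (\<forall>x. (x, x) \<notin> marcs G) \<and>
     (\<forall>x y. (x, y) \<in> marcs G \<longrightarrow> (y, x) \<notin> marcs G) \<and>
     (\<forall>x y. (x, y) \<in> marcs G \<longrightarrow> {x, y} \<notin> medges G)"

definition und_degree :: "'a mixed_graph \<Rightarrow> 'a \<Rightarrow> nat" where
  "und_degree G x = card {e \<in> medges G. x \<in> e}"

definition out_deg :: "'a mixed_graph \<Rightarrow> 'a \<Rightarrow> nat" where
  "out_deg G x = card {y. (x, y) \<in> marcs G}"

definition in_deg :: "'a mixed_graph \<Rightarrow> 'a \<Rightarrow> nat" where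
  "in_deg G x = card {y. (y, x) \<in> marcs G}"

definition max_und_degree :: "'a mixed_graph \<Rightarrow> nat" where
  "max_und_degree G = Max (und_degree G ` mverts G)"

definition orientable_path :: "'a mixed_graph \<Rightarrow> 'a \<Rightarrow> 'a list \<Rightarrow> 'a \<Rightarrow> bool" where
  "orientable_path G x xs y \<longleftrightarrow>
     xs \<noteq> [] \<and> distinct xs \<and> set xs \<subseteq> mverts G \<and> hd xs = x \<and> last xs = y \<and>
     (\<forall>i. Suc i < length xs \<longrightarrow>
        {xs ! i, xs ! Suc i} \<in> medges G \<or> (xs ! i, xs ! Suc i) \<in> marcs G)"

definition mixed_connected :: "'a mixed_graph \<Rightarrow> bool" where
  "mixed_connected G \<longleftrightarrow>
     (\<forall>x\<in>mverts G. \<forall>y\<in>mverts G.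
        (\<exists>xs. orientable_path G x xs y) \<and> (\<exists>xs. orientable_path G y xs x))"

definition del_edge :: "'a mixed_graph \<Rightarrow> 'a set \<Rightarrow> 'a mixed_graph" where
  "del_edge G e = G\<lparr>medges := medges G - {e}\<rparr>"

definition bridge :: "'a mixed_graph \<Rightarrow> 'a set \<Rightarrow> bool" where
  "bridge G e \<longleftrightarrow> e \<in> medges G \<and> \<not> mixed_connected (del_edge G e)"

definition bridgeless :: "'a mixed_graph \<Rightarrow> bool" where
  "bridgeless G \<longleftrightarrow> mixed_connected G \<and> (\<nexists>e. bridge G e)"

text \<open>The function \<open>d\<close> below chooses, for every undirected edge, one of its two directions.\<close>

definition orientations :: "'a mixed_graph \<Rightarrow> 'a pair_pre_digraph set" where
  "orientations G =
     {\<lparr>pverts = mverts G, parcs = marcs G \<union> d ` medges G\<rparr> | d.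
        \<forall>e\<in>medges G. {fst (d e), snd (d e)} = e}"

definition strong_orientations :: "'a mixed_graph \<Rightarrow> 'a pair_pre_digraph set" where
  "strong_orientations G = {H \<in> orientations G. strongly_connected (with_proj H)}"

definition distance :: "'a pair_pre_digraph \<Rightarrow> 'a \<Rightarrow> 'a \<Rightarrow> nat" where
  "distance H x y = (LEAST k. \<exists>p. pre_digraph.apath (with_proj H) x p y \<and> length p = k)"

definition diam :: "'a pair_pre_digraph \<Rightarrow> nat" where
  "diam H = Max {distance H x y | x y. x \<in> pverts H \<and> y \<in> pverts H}"

text \<open>The infimum of a nonempty set of natural numbers is its minimum. As the infimum of the
  empty set is \<open>0\<close>, a positive lower bound on the oriented diameter entails that a strong
  orientation exists.\<close>

definition oriented_diameter :: "'a mixed_graph \<Rightarrow> nat" where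
  "oriented_diameter G = Inf (diam ` strong_orientations G)"

text \<open>In a bridgeless mixed graph with at least two vertices, a vertex incident with no directed
  edge has undirected degree at least \<open>2\<close>: with degree \<open>0\<close> it is isolated, and with degree \<open>1\<close>
  its only edge is a bridge. Hence for \<open>\<Delta> \<le> 1\<close> and \<open>n \<ge> 2\<close> there is no graph of the kind
  constructed in the theorem, which is why the theorem assumes \<open>n = 1 \<or> 2 \<le> \<Delta>\<close>.\<close>

lemma no_graph_if_max_und_degree_le_1:
  fixes n \<Delta> :: nat
  assumes "\<Delta> < n" and excluded: "\<not> (n = 1 \<or> 2 \<le> \<Delta>)"
  shows "\<nexists>G :: 'a mixed_graph.
           mixed_graph G \<and> bridgeless G \<and> card (mverts G) = n \<and>
           (\<exists>u\<in>mverts G. und_degree G u = \<Delta> \<and> out_deg G u + in_deg G u = 0)"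
proof
  assume "\<exists>G :: 'a mixed_graph.
           mixed_graph G \<and> bridgeless G \<and> card (mverts G) = n \<and>
           (\<exists>u\<in>mverts G. und_degree G u = \<Delta> \<and> out_deg G u + in_deg G u = 0)"
  then obtain G :: "'a mixed_graph" and u where G: "mixed_graph G" and br: "bridgeless G"
    and n: "card (mverts G) = n" and u: "u \<in> mverts G" "und_degree G u = \<Delta>"
    and deg: "out_deg G u + in_deg G u = 0"
    by (elim exE conjE bexE) (rule that)
  have fin: "finite (mverts G)"
    using G by (simp add: mixed_graph_def)
  have "finite {y. (u, y) \<in> marcs G}"
    by (rule finite_subset[OF _ fin]) (use G in \<open>auto simp: mixed_graph_def\<close>)
  with deg have no_out: "(u, y) \<notin> marcs G" for y
    by (auto simp: out_deg_def)
  have "card (mverts G) \<ge> 2"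
    using assms n by auto
  then have "mverts G \<noteq> {u}"
    by auto
  then obtain v where v: "v \<in> mverts G" "v \<noteq> u"
    using u by blast
  have first: "\<exists>e \<in> medges H. u \<in> e"
    if H: "mixed_connected H" "mverts H = mverts G" "marcs H = marcs G" for H :: "'a mixed_graph"
  proof -
    obtain xs where xs: "orientable_path H u xs v"
      using H u v unfolding mixed_connected_def by metis
    then obtain y ys where "xs = u # y # ys"
      using v unfolding orientable_path_def
      by (cases xs; cases "tl xs") (auto split: if_splits)
    with xs have "{u, y} \<in> medges H \<or> (u, y) \<in> marcs H"
      unfolding orientable_path_def by (auto dest: spec[of _ 0])
    with no_out H show ?thesis
      by auto
  qed
  have "medges G \<subseteq> Pow (mverts G)"
    using G by (auto simp: mixed_graph_def)
  then have fin_e: "finite {e \<in> medges G. u \<in> e}"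
    by (rule finite_subset[OF subset_trans, rotated]) (use fin in auto)
  obtain e where e: "e \<in> medges G" "u \<in> e"
    using first[of G] br by (auto simp: bridgeless_def)
  then have "mixed_connected (del_edge G e)"
    using br by (auto simp: bridgeless_def bridge_def)
  from first[OF this] obtain e' where e': "e' \<in> medges G" "e' \<noteq> e" "u \<in> e'"
    by (auto simp: del_edge_def)
  have "card {e, e'} \<le> und_degree G u"
    unfolding und_degree_def by (rule card_mono[OF fin_e]) (use e e' in auto)
  with e' u excluded show False
    by auto
qed

end

theory Submission
  imports Defs
begin

text \<open>
  The graph consists of two blocks that share only the cut vertex \<open>u\<close>, the hub \<open>0\<close>. The long block
  is a directed cycle (its rim) of length \<open>l\<close>, of which \<open>s \<in> {2, 3}\<close> vertices are joined to the hub
  by undirected edges (the spokes). The short block is a directed cycle of length \<open>m\<close> with all of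
  its vertices joined to the hub; it is absent if \<open>m = 0\<close>. A directed cycle of length \<open>2\<close> is read as
  an undirected edge.

  Let a strong orientation be given. Since the hub is a cut vertex, it has both an out-neighbour
  and an in-neighbour in each block. As it has at most three neighbours in the long block, one of
  the two kinds occurs there only once. If there is only one out-neighbour \<open>j\<close>, then every walk from
  the hub into the long block has to enter it at \<open>j\<close> and to run along the directed rim, so the
  predecessor of \<open>j\<close> on the rim is at distance at least \<open>l\<close> from the hub. If there is only one
  in-neighbour \<open>i\<close>, then the successor of \<open>i\<close> on the rim needs at least \<open>l\<close> steps to the hub. In the
  short block, an out-neighbour of the hub needs at least two steps back to it, and an in-neighbour
  is at distance at least two from it. As all walks between the blocks pass through the hub, the
  diameter is at least \<open>l + 2\<close>, or at least \<open>l\<close> if the short block is absent; this is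
  \<open>two_wheels.diam_ge\<close>.

  The hub has undirected degree \<open>s + m = \<Delta>\<close> and there are \<open>l + m + 1 = n\<close> vertices. For \<open>\<Delta> \<ge> 5\<close> the
  choice \<open>s = 3\<close>, \<open>m = \<Delta> - 3\<close> gives \<open>l + 2 = n - \<Delta> + 4\<close>. For \<open>\<Delta> = 2, 3, 4\<close> the choices
  \<open>(s, m) = (2, 0), (3, 0), (2, 2)\<close> give the bound \<open>n - 1\<close>.

  As the oriented diameter is an infimum over the strong orientations, one such orientation has to be
  exhibited as well (\<open>two_wheels.ex_strong_orientation\<close>).
\<close>

section \<open>Mixed graphs as relations\<close>

text \<open>A mixed graph without loops is the same as an irreflexive relation \<open>R\<close>, where \<open>(x, y) \<in> R\<close> means
  that one may go from \<open>x\<close> to \<open>y\<close> in one step: a pair related in both directions is an undirected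
  edge, and a pair related in only one direction is a directed edge. All arguments below are about
  this relation.\<close>

definition mixed_graph_of :: "'a set \<Rightarrow> ('a \<times> 'a) set \<Rightarrow> 'a mixed_graph" where
  "mixed_graph_of V R =
     \<lparr>mverts = V, medges = {{x, y} | x y. (x, y) \<in> R \<and> (y, x) \<in> R}, marcs = R - R\<inverse>\<rparr>"

lemma mverts_mixed_graph_of [simp]: "mverts (mixed_graph_of V R) = V"
  by (simp add: mixed_graph_of_def)

lemma medges_mixed_graph_of_iff [simp]:
  "{x, y} \<in> medges (mixed_graph_of V R) \<longleftrightarrow> (x, y) \<in> R \<and> (y, x) \<in> R"
  by (auto simp: mixed_graph_of_def doubleton_eq_iff)

lemma medges_mixed_graph_ofE:
  assumes "e \<in> medges (mixed_graph_of V R)"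
  obtains x y where "e = {x, y}" "(x, y) \<in> R" "(y, x) \<in> R"
  using assms by (auto simp: mixed_graph_of_def)

lemma marcs_mixed_graph_of [simp]: "marcs (mixed_graph_of V R) = R - R\<inverse>"
  by (simp add: mixed_graph_of_def)

lemma mixed_graph_mixed_graph_of:
  assumes "finite V" "R \<subseteq> V \<times> V" "irrefl R"
  shows "mixed_graph (mixed_graph_of V R)"
  using assms
  by (fastforce simp: mixed_graph_def irrefl_def card_insert_if elim!: medges_mixed_graph_ofE)

lemma und_degree_mixed_graph_of:
  assumes "irrefl R"
  shows "und_degree (mixed_graph_of V R) x = card {y. (x, y) \<in> R \<and> (y, x) \<in> R}"
proof -
  have "{e \<in> medges (mixed_graph_of V R). x \<in> e}
      = (\<lambda>y. {x, y}) ` {y. (x, y) \<in> R \<and> (y, x) \<in> R}"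
    by (auto elim!: medges_mixed_graph_ofE)
  moreover have "inj_on (\<lambda>y. {x, y}) {y. (x, y) \<in> R \<and> (y, x) \<in> R}"
    by (auto simp: inj_on_def doubleton_eq_iff)
  ultimately show ?thesis
    by (simp add: und_degree_def card_image)
qed

section \<open>Connectedness through a hub\<close>

definition steps :: "'a mixed_graph \<Rightarrow> ('a \<times> 'a) set" where
  "steps G = {(x, y). {x, y} \<in> medges G \<or> (x, y) \<in> marcs G}"

text \<open>Vertices on an orientable path are distinct. The path is extended step by step; when a step
  returns to a vertex of the path, the path is cut off there.\<close>

lemma orientable_path_if_rtrancl:
  assumes "(x, y) \<in> (steps G)\<^sup>*" "x \<in> mverts G" "steps G \<subseteq> mverts G \<times> mverts G"
  shows "\<exists>xs. orientable_path G x xs y"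
  using assms(1)
proof (induction rule: rtrancl_induct)
  case base
  show ?case
    using assms(2) by (intro exI[of _ "[x]"]) (simp add: orientable_path_def)
next
  case (step y z)
  then obtain xs where xs: "orientable_path G x xs y"
    by blast
  show ?case
  proof (cases "z \<in> set xs")
    case True
    then obtain as bs where "xs = as @ z # bs"
      by (auto dest: split_list)
    then have "xs = (as @ [z]) @ bs"
      by simp
    with xs have "orientable_path G x (as @ [z]) z"
      unfolding orientable_path_def
      by (auto simp: hd_append nth_append split: if_splits)
    then show ?thesis
      by blast
  next
    case False
    have "orientable_path G x (xs @ [z]) z"
      unfolding orientable_path_def
    proof (intro conjI allI impI)
      fix i
      assume i: "Suc i < length (xs @ [z])"
      show "{(xs @ [z]) ! i, (xs @ [z]) ! Suc i} \<in> medges G \<or>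
          ((xs @ [z]) ! i, (xs @ [z]) ! Suc i) \<in> marcs G"
      proof (cases "Suc i < length xs")
        case True
        then show ?thesis
          using xs by (auto simp: orientable_path_def nth_append)
      next
        case False
        with i have "Suc i = length xs"
          by simp
        moreover from this have "xs ! i = y"
          using xs by (metis diff_Suc_1 last_conv_nth orientable_path_def)
        ultimately show ?thesis
          using step(2) by (auto simp: nth_append steps_def)
      qed
    qed (use xs False step assms(3) in \<open>auto simp: orientable_path_def\<close>)
    then show ?thesis
      by blast
  qed
qed

definition hub_connected :: "'a \<Rightarrow> ('a \<times> 'a) set \<Rightarrow> 'a set \<Rightarrow> bool" where
  "hub_connected h r A \<longleftrightarrow> (\<forall>v\<in>A. (h, v) \<in> r\<^sup>* \<and> (v, h) \<in> r\<^sup>*)"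

lemma hub_connected_mono:
  assumes "hub_connected h r A" "r \<subseteq> r'"
  shows "hub_connected h r' A"
  using assms rtrancl_mono[of r r'] by (auto simp: hub_connected_def)

lemma hub_connected_Un:
  assumes "hub_connected h r A" "hub_connected h r' B"
  shows "hub_connected h (r \<union> r') (insert h (A \<union> B))"
  using assms hub_connected_mono[OF assms(1), of "r \<union> r'"] hub_connected_mono[OF assms(2), of "r \<union> r'"]
  by (auto simp: hub_connected_def)

lemma hub_connected_imp_Times_subset: "hub_connected h r A \<Longrightarrow> A \<times> A \<subseteq> r\<^sup>*"
  by (auto simp: hub_connected_def intro: rtrancl_trans)

lemma mixed_connected_if_hub_connected:
  assumes "hub_connected h (steps G) (mverts G)" "steps G \<subseteq> mverts G \<times> mverts G"
  shows "mixed_connected G"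
  using assms hub_connected_imp_Times_subset[OF assms(1)]
  by (auto simp: mixed_connected_def intro!: orientable_path_if_rtrancl)

lemma steps_mixed_graph_of [simp]: "steps (mixed_graph_of V R) = R"
  by (auto simp: steps_def)

lemma steps_del_edge_mixed_graph_of:
  assumes "(x, y) \<in> R" "(y, x) \<in> R"
  shows "steps (del_edge (mixed_graph_of V R) {x, y}) = R - {(x, y), (y, x)}"
  using assms by (auto simp: steps_def del_edge_def doubleton_eq_iff)

section \<open>Orientations\<close>

text \<open>In relational form an orientation of \<open>R\<close> is an antisymmetric subrelation \<open>T\<close> with the same
  symmetric closure. This eliminates the function that chooses directions: it is recovered from \<open>T\<close>
  by assigning to every edge the pair of \<open>T\<close> on it, which is unique by antisymmetry.\<close>

lemma orientations_mixed_graph_of: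
  assumes "irrefl R"
  shows "orientations (mixed_graph_of V R) =
    {\<lparr>pverts = V, parcs = T\<rparr> | T. T \<subseteq> R \<and> R \<subseteq> T \<union> T\<inverse> \<and> T \<inter> T\<inverse> = {}}" (is "_ = ?O")
proof (intro subset_antisym subsetI)
  let ?E = "medges (mixed_graph_of V R)"
  fix H
  assume "H \<in> orientations (mixed_graph_of V R)"
  then obtain d where H: "H = \<lparr>pverts = V, parcs = (R - R\<inverse>) \<union> d ` ?E\<rparr>"
    and d: "\<And>e. e \<in> ?E \<Longrightarrow> {fst (d e), snd (d e)} = e"
    by (auto simp: orientations_def)
  let ?T = "(R - R\<inverse>) \<union> d ` ?E"
  have dE: "d e \<in> R" "prod.swap (d e) \<in> R" if "e \<in> ?E" for e
    using d[OF that] that by (cases "d e"; metis fst_conv snd_conv swap_simp medges_mixed_graph_of_iff)+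
  have "?T \<subseteq> R"
    using dE by auto
  moreover have "R \<subseteq> ?T \<union> ?T\<inverse>"
  proof
    fix z
    assume "z \<in> R"
    then obtain x y where z: "z = (x, y)" "(x, y) \<in> R"
      by (cases z) auto
    show "z \<in> ?T \<union> ?T\<inverse>"
    proof (cases "(y, x) \<in> R")
      case True
      then have e: "{x, y} \<in> ?E"
        using z by simp
      from d[OF this] have "d {x, y} = (x, y) \<or> d {x, y} = (y, x)"
        by (cases "d {x, y}") (auto simp: doubleton_eq_iff)
      then show ?thesis
        using e z(1) by (metis UnCI converseI imageI)
    qed (use z in auto)
  qed
  moreover have "?T \<inter> ?T\<inverse> = {}"
  proof (rule ccontr)
    assume "?T \<inter> ?T\<inverse> \<noteq> {}"
    then obtain x y where xy: "(x, y) \<in> ?T" "(y, x) \<in> ?T"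
      by auto
    with \<open>?T \<subseteq> R\<close> have "(x, y) \<in> R" "(y, x) \<in> R"
      by blast+
    with xy have "(x, y) \<in> d ` ?E" "(y, x) \<in> d ` ?E"
      by blast+
    then obtain e e' where e: "e \<in> ?E" "d e = (x, y)" "e' \<in> ?E" "d e' = (y, x)"
      by (elim imageE) simp
    have "{x, y} = e" "{y, x} = e'"
      using d[OF e(1)] d[OF e(3)] by (simp_all add: e(2,4))
    then have "e = e'"
      by (metis insert_commute)
    with e have "x = y"
      by (metis Pair_inject)
    with \<open>(x, y) \<in> R\<close> assms show False
      by (simp add: irrefl_def)
  qed
  ultimately show "H \<in> ?O"
    using H by blast
next
  let ?E = "medges (mixed_graph_of V R)"
  fix H
  assume "H \<in> ?O"
  then obtain T where H: "H = \<lparr>pverts = V, parcs = T\<rparr>"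
    and T: "T \<subseteq> R" "R \<subseteq> T \<union> T\<inverse>" "T \<inter> T\<inverse> = {}"
    by blast
  have "\<forall>e\<in>?E. \<exists>z. z \<in> T \<and> {fst z, snd z} = e"
  proof
    fix e
    assume "e \<in> ?E"
    then obtain x y where e: "e = {x, y}" "(x, y) \<in> R"
      by (elim medges_mixed_graph_ofE)
    with T(2) have "(x, y) \<in> T \<or> (y, x) \<in> T"
      by blast
    with e show "\<exists>z. z \<in> T \<and> {fst z, snd z} = e"
      by (metis fst_conv snd_conv insert_commute)
  qed
  then obtain d where d: "\<And>e. e \<in> ?E \<Longrightarrow> d e \<in> T" "\<And>e. e \<in> ?E \<Longrightarrow> {fst (d e), snd (d e)} = e"
    by metis
  have "T \<subseteq> (R - R\<inverse>) \<union> d ` ?E"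
  proof
    fix z
    assume z: "z \<in> T"
    obtain x y where xy: "z = (x, y)"
      by (cases z)
    show "z \<in> (R - R\<inverse>) \<union> d ` ?E"
    proof (cases "(y, x) \<in> R")
      case True
      then have e: "{x, y} \<in> ?E"
        using z xy T(1) by auto
      have "d {x, y} = (x, y) \<or> d {x, y} = (y, x)"
        using d(2)[OF e] by (cases "d {x, y}") (auto simp: doubleton_eq_iff)
      moreover have "(y, x) \<notin> T"
        using z xy T(3) by blast
      ultimately have "d {x, y} = z"
        using d(1)[OF e] xy by auto
      then show ?thesis
        using e by (metis UnCI imageI)
    qed (use z xy T in auto)
  qed
  moreover have "(R - R\<inverse>) \<union> d ` ?E \<subseteq> T"
    using d(1) T by blast
  ultimately have "T = marcs (mixed_graph_of V R) \<union> d ` ?E"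
    by simp
  with H d(2) show "H \<in> orientations (mixed_graph_of V R)"
    unfolding orientations_def by auto
qed

lemma strongly_connected_pair_digraph_iff:
  assumes "T \<subseteq> V \<times> V"
  shows "strongly_connected (with_proj \<lparr>pverts = V, parcs = T\<rparr>) \<longleftrightarrow> V \<noteq> {} \<and> V \<times> V \<subseteq> T\<^sup>*"
proof -
  interpret pair_wf_digraph "\<lparr>pverts = V, parcs = T\<rparr>"
    using assms by unfold_locales auto
  show ?thesis
    using reachable_conv' by (auto simp: strongly_connected_def)
qed

section \<open>Lower bounds for distances\<close>

text \<open>All lower bounds for distances come from a potential that grows by at most \<open>1\<close> along each arc.
  Reachability is needed because the distance between unreachable vertices is the least element
  of the empty set, which is an unspecified number.\<close>

lemma potential_le_distance:
  assumes T: "T \<subseteq> V \<times> V" and xy: "x \<in> V" "y \<in> V" "(x, y) \<in> T\<^sup>*"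
    and f: "\<And>u v. (u, v) \<in> T \<Longrightarrow> f v \<le> f u + (1 :: nat)"
  shows "f y \<le> f x + distance \<lparr>pverts = V, parcs = T\<rparr> x y"
proof -
  interpret pair_wf_digraph "\<lparr>pverts = V, parcs = T\<rparr>"
    using T by unfold_locales auto
  have "reachable (with_proj \<lparr>pverts = V, parcs = T\<rparr>) x y"
    using reachable_conv' xy by simp
  then have "\<exists>k p. apath x p y \<and> length p = k"
    by (simp add: reachable_apath)
  then have "\<exists>p. apath x p y \<and> length p = distance \<lparr>pverts = V, parcs = T\<rparr> x y"
    unfolding distance_def by (rule LeastI_ex)
  then obtain p where p: "awalk x p y" "length p = distance \<lparr>pverts = V, parcs = T\<rparr> x y"
    by (auto simp: apath_def)
  have "f y \<le> f x + length p"
    using p(1)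
  proof (induction p arbitrary: x)
    case Nil
    then show ?case
      by (simp add: awalk_Nil_iff)
  next
    case (Cons e p)
    then have "f y \<le> f (snd e) + length p" "(x, snd e) \<in> T"
      by (auto simp: awalk_Cons_iff)
    with f[of x "snd e"] show ?case
      by simp
  qed
  with p(2) show ?thesis
    by simp
qed

lemma distance_le_diam:
  assumes "finite (pverts H)" "x \<in> pverts H" "y \<in> pverts H"
  shows "distance H x y \<le> diam H"
proof -
  have "{distance H x y | x y. x \<in> pverts H \<and> y \<in> pverts H}
      = (\<lambda>(x, y). distance H x y) ` (pverts H \<times> pverts H)"
    by auto
  with assms show ?thesis
    unfolding diam_def by (intro Max_ge) auto
qed

text \<open>Applied to the rim of a block this yields an arc that leaves the block, and applied to the complement
  of the rim an arc that enters it.\<close>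

lemma rtrancl_leaves_set:
  assumes "(a, b) \<in> r\<^sup>*" "a \<in> X" "b \<notin> X"
  shows "\<exists>x\<in>X. \<exists>y. y \<notin> X \<and> (x, y) \<in> r"
  using assms by (induction rule: converse_rtrancl_induct) blast+

section \<open>Wheels\<close>

text \<open>For \<open>q = p + 1\<close> both pairs on \<open>{p, q}\<close> are in the relation, which therefore encodes an undirected
  edge. For \<open>q \<le> p\<close> there are no pairs at all, so that a block with \<open>q < p\<close> is empty.\<close>

definition rim :: "nat \<Rightarrow> nat \<Rightarrow> (nat \<times> nat) set" where
  "rim p q = {(i, Suc i) | i. p \<le> i \<and> i < q} \<union> (if p < q then {(q, p)} else {})"

definition wheel :: "nat \<Rightarrow> nat \<Rightarrow> nat \<Rightarrow> (nat \<times> nat) set" where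
  "wheel p r q = rim p q \<union> {0} \<times> {p..r} \<union> {p..r} \<times> {0}"

text \<open>A strong orientation of the wheel. On a rim of two vertices the edge between them is oriented
  upwards; the hub is left only towards \<open>p\<close>, the first vertex of the rim.\<close>

definition oriented_wheel :: "nat \<Rightarrow> nat \<Rightarrow> nat \<Rightarrow> (nat \<times> nat) set" where
  "oriented_wheel p r q =
     {(i, Suc i) | i. p \<le> i \<and> i < q} \<union> (if Suc p < q then {(q, p)} else {}) \<union>
     (if p \<le> r then {(0, p)} else {}) \<union> {Suc p..r} \<times> {0}"

lemma rim_iff: "(x, y) \<in> rim p q \<longleftrightarrow> p \<le> x \<and> x < q \<and> y = Suc x \<or> x = q \<and> y = p \<and> p < q"
  by (auto simp: rim_def)

lemma wheel_iff: "(x, y) \<in> wheel p r q \<longleftrightarrow>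
    (x, y) \<in> rim p q \<or> x = 0 \<and> y \<in> {p..r} \<or> y = 0 \<and> x \<in> {p..r}"
  by (auto simp: wheel_def)

lemma oriented_wheel_iff: "(x, y) \<in> oriented_wheel p r q \<longleftrightarrow>
    p \<le> x \<and> x < q \<and> y = Suc x \<or> x = q \<and> y = p \<and> Suc p < q \<or>
    x = 0 \<and> y = p \<and> p \<le> r \<or> y = 0 \<and> x \<in> {Suc p..r}"
  by (auto simp: oriented_wheel_def)

lemma rtrancl_ascending:
  assumes "\<And>i. p \<le> i \<Longrightarrow> i < q \<Longrightarrow> (i, Suc i) \<in> r" "p \<le> a" "a \<le> b" "b \<le> q"
  shows "(a, b) \<in> r\<^sup>*"
  using assms(3,4,2)
proof (induction rule: dec_induct)
  case (step i)
  with assms(1)[of i] show ?case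
    by (auto intro: rtrancl_into_rtrancl)
qed simp

lemma rtrancl_rim:
  assumes "a \<in> {p..q}" "b \<in> {p..q}"
  shows "(a, b) \<in> (rim p q)\<^sup>*"
proof -
  have up: "(i, j) \<in> (rim p q)\<^sup>*" if "p \<le> i" "i \<le> j" "j \<le> q" for i j
    by (rule rtrancl_ascending[OF _ that]) (simp add: rim_iff)
  have "(q, p) \<in> (rim p q)\<^sup>*"
    using assms by (cases "p = q") (auto simp: rim_iff)
  with up[of a q] up[of p b] show ?thesis
    using assms by (auto intro: rtrancl_trans)
qed

lemma rim_subset: "rim p q \<subseteq> {p..q} \<times> {p..q}"
  by (auto simp: rim_def)

text \<open>Along a directed cycle no pair is related in both directions, except on a rim \<open>{p, p + 1}\<close> of two
  vertices. The equation then determines \<open>y\<close> from \<open>x\<close>, so a rim vertex has at most one undirected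
  neighbour besides the hub.\<close>

lemma rim_symD:
  assumes "(x, y) \<in> rim p q" "(y, x) \<in> rim p q"
  shows "x + y = p + q"
  using assms unfolding rim_iff by (elim disjE conjE) linarith+

lemma wheel_symD:
  assumes "(x, y) \<in> wheel p r q" "(y, x) \<in> wheel p r q" "x \<noteq> 0"
  shows "y = 0 \<or> x + y = p + q"
  using assms rim_symD[of x y p q] by (auto simp: wheel_iff)

lemma wheel_subset:
  assumes "r \<le> q"
  shows "wheel p r q \<subseteq> {p..q} \<times> insert 0 {p..q} \<union> insert 0 {p..q} \<times> {p..q}"
  using assms by (auto simp: wheel_def rim_def)

text \<open>A wheel stays connected when an undirected edge is removed: the rim is a directed cycle, and of its
  at least two spokes one remains. If the removed edge is itself the rim, then both of its endpoints
  have a spoke. The hypothesis on \<open>(x, y)\<close> says that the removed pairs form an undirected edge of the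
  wheel or do not meet the wheel; the latter case serves the removal of an edge of another wheel.\<close>

lemma hub_connected_wheel_del_edge:
  assumes "0 < p" "p < r" "r \<le> q" and xy: "(x, y) \<in> wheel p r q \<longleftrightarrow> (y, x) \<in> wheel p r q"
  shows "hub_connected 0 (wheel p r q - {(x, y), (y, x)}) {p..q}" (is "hub_connected 0 ?W _")
proof (cases "(x, y) \<in> rim p q \<or> (y, x) \<in> rim p q")
  case True
  then have "q = Suc p" "x \<noteq> 0" "y \<noteq> 0"
    using assms by (auto simp: wheel_iff rim_iff)
  then have "(0, v) \<in> ?W \<and> (v, 0) \<in> ?W" if "v \<in> {p..q}" for v
    using that assms by (auto simp: wheel_iff)
  then show ?thesis
    unfolding hub_connected_def by blast
next
  case False
  then have "rim p q \<subseteq> ?W"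
    by (auto simp: wheel_def)
  then have rim: "(a, b) \<in> ?W\<^sup>*" if "a \<in> {p..q}" "b \<in> {p..q}" for a b
    using rtrancl_rim[OF that] rtrancl_mono by blast
  (* the end of a spoke that is not removed *)
  define j where "j = (if x = p \<or> y = p then r else p)"
  have "(0, j) \<in> ?W" "(j, 0) \<in> ?W" and j: "j \<in> {p..q}"
    using assms(1-3) by (auto simp: wheel_iff j_def)
  then show ?thesis
    using rim[OF j] rim[OF _ j] unfolding hub_connected_def
    by (blast intro: converse_rtrancl_into_rtrancl rtrancl_into_rtrancl)
qed

lemma hub_connected_oriented_wheel:
  assumes "p < r" "r \<le> q"
  shows "hub_connected 0 (oriented_wheel p r q) {p..q}"
  unfolding hub_connected_def
proof
  let ?T = "oriented_wheel p r q"
  fix v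
  assume v: "v \<in> {p..q}"
  have up: "(i, j) \<in> ?T\<^sup>*" if "p \<le> i" "i \<le> j" "j \<le> q" for i j
    by (rule rtrancl_ascending[OF _ that]) (simp add: oriented_wheel_iff)
  have hub: "(0, p) \<in> ?T" "(r, 0) \<in> ?T"
    using assms by (auto simp: oriented_wheel_iff)
  (* Above r the rim has at least three vertices, so the oriented rim is still a cycle. *)
  have "(v, r) \<in> ?T\<^sup>*"
  proof (cases "v \<le> r")
    case False
    then have "(q, p) \<in> ?T"
      using assms v by (auto simp: oriented_wheel_iff)
    with up[of v q] up[of p r] show ?thesis
      using assms v by (auto intro: rtrancl_trans)
  qed (use up[of v r] assms v in auto)
  with hub show "(0, v) \<in> ?T\<^sup>* \<and> (v, 0) \<in> ?T\<^sup>*"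
    using up[of p v] v by (auto intro: converse_rtrancl_into_rtrancl rtrancl_into_rtrancl)
qed

lemma orientation_of_wheel:
  assumes "0 < p" "r \<le> q"
  shows "oriented_wheel p r q \<subseteq> wheel p r q"
    and "wheel p r q \<subseteq> oriented_wheel p r q \<union> (oriented_wheel p r q)\<inverse>"
    and "oriented_wheel p r q \<inter> (oriented_wheel p r q)\<inverse> = {}"
proof -
  have "(x, y) \<in> wheel p r q" if "(x, y) \<in> oriented_wheel p r q" for x y
    using that unfolding oriented_wheel_iff by (elim disjE conjE) (simp_all add: wheel_iff rim_iff)
  then show "oriented_wheel p r q \<subseteq> wheel p r q"
    by (rule subrelI)
  have rim: "(x, y) \<in> oriented_wheel p r q \<or> (y, x) \<in> oriented_wheel p r q"
    if "(x, y) \<in> rim p q" for x y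
  proof (cases "p \<le> x \<and> x < q \<and> y = Suc x")
    case False
    with that have "x = q" "y = p" "p < q"
      by (simp_all add: rim_iff)
    then show ?thesis
      by (cases "Suc p < q") (simp_all add: oriented_wheel_iff)
  qed (simp add: oriented_wheel_iff)
  have spoke: "(0, x) \<in> oriented_wheel p r q \<or> (x, 0) \<in> oriented_wheel p r q"
    if "x \<in> {p..r}" for x
    using that by (cases "x = p") (auto simp: oriented_wheel_iff)
  have "(x, y) \<in> oriented_wheel p r q \<union> (oriented_wheel p r q)\<inverse>" if "(x, y) \<in> wheel p r q" for x y
    using that rim[of x y] spoke[of x] spoke[of y] unfolding wheel_iff by blast
  then show "wheel p r q \<subseteq> oriented_wheel p r q \<union> (oriented_wheel p r q)\<inverse>"
    by (rule subrelI)
  have "\<not> ((x, y) \<in> oriented_wheel p r q \<and> (y, x) \<in> oriented_wheel p r q)" for x y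
    using assms unfolding oriented_wheel_iff atLeastAtMost_iff by (intro notI, elim conjE disjE) linarith+
  then show "oriented_wheel p r q \<inter> (oriented_wheel p r q)\<inverse> = {}"
    by blast
qed

text \<open>The number of steps from \<open>a\<close> to \<open>b\<close> along the directed cycle \<open>rim 1 l\<close>.\<close>

definition rim_dist :: "nat \<Rightarrow> nat \<Rightarrow> nat \<Rightarrow> nat" where
  "rim_dist l a b = (if a \<le> b then b - a else l + b - a)"

lemma rim_dist_self [simp]: "rim_dist l a a = 0"
  by (simp add: rim_dist_def)

lemma rim_dist_le:
  assumes "a \<in> {1..l}" "b \<in> {1..l}"
  shows "rim_dist l a b \<le> l"
  using assms by (auto simp: rim_dist_def)

lemma rim_dist_step:
  assumes "(x, y) \<in> rim 1 l" "a \<in> {1..l}"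
  shows "rim_dist l a y \<le> rim_dist l a x + 1"
  using assms unfolding rim_iff by (elim disjE conjE) (auto simp: rim_dist_def)

section \<open>Two wheels with a common hub\<close>

text \<open>The long block has the rim \<open>{1..l}\<close> and the spokes at \<open>{1..s}\<close>, and the short block has the rim
  \<open>{l + 1..l + m}\<close> with a spoke at every vertex. With \<open>s = 1\<close> or \<open>m = 1\<close> a single spoke would be a
  bridge, and for \<open>s \<le> 3\<close> the hub has only one out-neighbour or only one in-neighbour in the long
  block.\<close>

locale two_wheels =
  fixes l s m :: nat
  assumes two_le_s: "2 \<le> s" and s_le_3: "s \<le> 3" and s_le_l: "s \<le> l" and m_neq_1: "m \<noteq> 1"
begin

definition V :: "nat set" where
  "V = {0..l + m}"

definition R :: "(nat \<times> nat) set" where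
  "R = wheel 1 s l \<union> wheel (Suc l) (l + m) (l + m)"

lemma finite_V: "finite V"
  by (simp add: V_def)

lemma V_eq: "V = insert 0 ({1..l} \<union> {Suc l..l + m})"
  by (auto simp: V_def)

lemma R_subset: "R \<subseteq> V \<times> V"
  using s_le_l wheel_subset[OF s_le_l, of 1] wheel_subset[OF order_refl, of "Suc l" "l + m"]
  unfolding R_def V_eq by blast

lemma irrefl_R: "irrefl R"
  by (auto simp: irrefl_def R_def wheel_def rim_def)

lemma wheels_disjoint:
  assumes "(x, y) \<in> wheel 1 s l"
  shows "(x, y) \<notin> wheel (Suc l) (l + m) (l + m)" "(y, x) \<notin> wheel (Suc l) (l + m) (l + m)"
proof -
  have "x \<in> {1..l} \<or> y \<in> {1..l}"
    using subsetD[OF wheel_subset assms] s_le_l by auto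
  moreover have "{u, v} \<subseteq> insert 0 {Suc l..l + m}" if "(u, v) \<in> wheel (Suc l) (l + m) (l + m)" for u v
    using subsetD[OF wheel_subset that] by auto
  ultimately show "(x, y) \<notin> wheel (Suc l) (l + m) (l + m)" "(y, x) \<notin> wheel (Suc l) (l + m) (l + m)"
    by fastforce+
qed

lemma mixed_graph: "mixed_graph (mixed_graph_of V R)"
  using finite_V R_subset irrefl_R by (rule mixed_graph_mixed_graph_of)

lemma hub_connected_R_del_edge:
  assumes "(x, y) \<in> R \<longleftrightarrow> (y, x) \<in> R"
  shows "hub_connected 0 (R - {(x, y), (y, x)}) V"
proof -
  have "(x, y) \<in> wheel 1 s l \<longleftrightarrow> (y, x) \<in> wheel 1 s l"
    "(x, y) \<in> wheel (Suc l) (l + m) (l + m) \<longleftrightarrow> (y, x) \<in> wheel (Suc l) (l + m) (l + m)"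
    using assms wheels_disjoint[of x y] wheels_disjoint[of y x] by (auto simp: R_def)
  then have A: "hub_connected 0 (wheel 1 s l - {(x, y), (y, x)}) {1..l}"
    and B: "hub_connected 0 (wheel (Suc l) (l + m) (l + m) - {(x, y), (y, x)}) {Suc l..l + m}"
    using two_le_s s_le_l m_neq_1 hub_connected_wheel_del_edge[of 1 s l x y]
      hub_connected_wheel_del_edge[of "Suc l" "l + m" "l + m" x y]
    by (cases "m = 0"; simp add: hub_connected_def)+
  show ?thesis
    using hub_connected_Un[OF A B] by (simp add: V_eq R_def Un_Diff)
qed

lemma bridgeless: "bridgeless (mixed_graph_of V R)"
proof -
  have "(0, 0) \<notin> R"
    using irrefl_R by (simp add: irrefl_def)
  (* removing the pair (0, 0), which is not in R, changes nothing *)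
  then have "hub_connected 0 R V"
    using hub_connected_R_del_edge[of 0 0] by simp
  then have "mixed_connected (mixed_graph_of V R)"
    using R_subset by (intro mixed_connected_if_hub_connected[of 0]) simp_all
  moreover have "\<not> bridge (mixed_graph_of V R) e" for e
  proof
    assume e: "bridge (mixed_graph_of V R) e"
    then have "e \<in> medges (mixed_graph_of V R)"
      by (simp add: bridge_def)
    then obtain x y where xy: "e = {x, y}" "(x, y) \<in> R" "(y, x) \<in> R"
      by (rule medges_mixed_graph_ofE)
    have "mverts (del_edge (mixed_graph_of V R) e) = V"
      by (simp add: del_edge_def)
    with xy have "mixed_connected (del_edge (mixed_graph_of V R) e)"
      using R_subset hub_connected_R_del_edge[of x y]
      by (intro mixed_connected_if_hub_connected[of 0]) (auto simp: steps_del_edge_mixed_graph_of)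
    with e show False
      by (simp add: bridge_def)
  qed
  ultimately show ?thesis
    by (simp add: bridgeless_def)
qed

lemma und_degree_hub: "und_degree (mixed_graph_of V R) 0 = s + m"
proof -
  have "{y. (0, y) \<in> R \<and> (y, 0) \<in> R} = {1..s} \<union> {Suc l..l + m}"
    by (auto simp: R_def wheel_iff rim_iff)
  moreover have "card \<dots> = s + m"
    using s_le_l by (subst card_Un_disjoint) auto
  ultimately show ?thesis
    by (simp add: und_degree_mixed_graph_of[OF irrefl_R])
qed

text \<open>Besides the hub, a rim vertex has an undirected neighbour only if its rim is a single edge. Hence its
  undirected degree is at most \<open>2 \<le> s\<close>.\<close>

lemma und_degree_le:
  assumes "x \<in> V"
  shows "und_degree (mixed_graph_of V R) x \<le> s + m"
proof (cases "x = 0")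
  case False
  have "y \<in> {0, if x \<le> l then 1 + l - x else 1 + l + (l + m) - x}"
    if "(x, y) \<in> R" "(y, x) \<in> R" for y
  proof (cases "(x, y) \<in> wheel 1 s l")
    case True
    then have "(y, x) \<in> wheel 1 s l" "x \<le> l"
      using that wheels_disjoint[OF True] subsetD[OF wheel_subset True] s_le_l by (auto simp: R_def)
    then show ?thesis
      using wheel_symD[OF True _ False] by auto
  next
    case not1: False
    then have 2: "(x, y) \<in> wheel (Suc l) (l + m) (l + m)"
      using that by (simp add: R_def)
    then have "(y, x) \<in> wheel (Suc l) (l + m) (l + m)" "l < x"
      using that wheels_disjoint(2)[of y x] subsetD[OF wheel_subset 2] False by (auto simp: R_def)
    then show ?thesis
      using wheel_symD[OF 2 _ False] by auto
  qed
  then obtain w where "{y. (x, y) \<in> R \<and> (y, x) \<in> R} \<subseteq> {0, w}"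
    by blast
  then have "card {y. (x, y) \<in> R \<and> (y, x) \<in> R} \<le> card {0, w}"
    by (intro card_mono) auto
  also have "\<dots> \<le> 2"
    by (simp add: card_insert_if)
  finally show ?thesis
    using two_le_s by (simp add: und_degree_mixed_graph_of[OF irrefl_R])
qed (simp add: und_degree_hub)

lemma max_und_degree: "max_und_degree (mixed_graph_of V R) = s + m"
  unfolding max_und_degree_def
proof (rule Max_eqI)
  show "s + m \<in> und_degree (mixed_graph_of V R) ` mverts (mixed_graph_of V R)"
    using und_degree_hub by (intro image_eqI[of _ _ 0]) (simp_all add: V_def)
qed (use und_degree_le finite_V in auto)

lemma no_arcs_at_hub:
  "out_deg (mixed_graph_of V R) 0 + in_deg (mixed_graph_of V R) 0 = 0"
proof -
  have "(0, y) \<in> R \<longleftrightarrow> (y, 0) \<in> R" for y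
    using s_le_l by (auto simp: R_def wheel_iff rim_iff)
  then show ?thesis
    by (simp add: out_deg_def in_deg_def)
qed

lemma ex_strong_orientation: "strong_orientations (mixed_graph_of V R) \<noteq> {}"
proof -
  define T where "T = oriented_wheel 1 s l \<union> oriented_wheel (Suc l) (l + m) (l + m)"
  note A = orientation_of_wheel[OF zero_less_one s_le_l]
    and B = orientation_of_wheel[OF zero_less_Suc order_refl, of l "l + m"]
  have TR: "T \<subseteq> R"
    using A(1) B(1) unfolding T_def R_def by blast
  moreover have "R \<subseteq> T \<union> T\<inverse>"
    using A(2) B(2) unfolding T_def R_def by blast
  moreover have "T \<inter> T\<inverse> = {}"
  proof -
    have "(y, x) \<notin> T" if "(x, y) \<in> T" for x y
      using that A(1,3) B(1,3) wheels_disjoint[of x y] wheels_disjoint[of y x] unfolding T_def by blast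
    then show ?thesis
      by blast
  qed
  ultimately have "\<lparr>pverts = V, parcs = T\<rparr> \<in> orientations (mixed_graph_of V R)"
    by (auto simp: orientations_mixed_graph_of[OF irrefl_R])
  moreover have "hub_connected 0 T V"
  proof -
    have "hub_connected 0 (oriented_wheel 1 s l) {1..l}"
      "hub_connected 0 (oriented_wheel (Suc l) (l + m) (l + m)) {Suc l..l + m}"
      using hub_connected_oriented_wheel[of 1 s l] two_le_s s_le_l m_neq_1
        hub_connected_oriented_wheel[of "Suc l" "l + m" "l + m"]
      by (cases "m = 0"; simp add: hub_connected_def)+
    from hub_connected_Un[OF this] show ?thesis
      by (simp add: V_eq T_def)
  qed
  then have "strongly_connected (with_proj \<lparr>pverts = V, parcs = T\<rparr>)"
    using TR R_subset hub_connected_imp_Times_subset[of 0 T V]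
    by (subst strongly_connected_pair_digraph_iff) (auto simp: V_def)
  ultimately show ?thesis
    by (auto simp: strong_orientations_def)
qed

text \<open>The first case below is that of a unique out-neighbour \<open>j\<close> of the hub in the long block, the second
  that of a unique in-neighbour \<open>i\<close>. The potentials are lower bounds for distances: in the first case
  for the distance from a vertex \<open>b\<close> of the short block, in the second for the distance from a vertex
  \<open>z\<close> of the long block. If the short block is absent, then \<open>b\<close> is the hub itself. The number \<open>k\<close> is
  the length that the short block contributes.\<close>

lemma diam_ge:
  assumes "H \<in> strong_orientations (mixed_graph_of V R)"
  shows "l + (if m = 0 then 0 else 2) \<le> diam H"
proof -
  obtain T where H: "H = \<lparr>pverts = V, parcs = T\<rparr>"
    and T: "T \<subseteq> R" "R \<subseteq> T \<union> T\<inverse>" "T \<inter> T\<inverse> = {}"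
    and strong: "strongly_connected (with_proj H)"
    using assms by (auto simp: strong_orientations_def orientations_mixed_graph_of[OF irrefl_R])
  have TV: "T \<subseteq> V \<times> V"
    using T(1) R_subset by blast
  have conn: "(x, y) \<in> T\<^sup>*" if "x \<in> V" "y \<in> V" for x y
    using strong that by (auto simp: H strongly_connected_pair_digraph_iff[OF TV])
  have bound: "f y \<le> f x + diam H"
    if "x \<in> V" "y \<in> V" "\<And>u v. (u, v) \<in> T \<Longrightarrow> f v \<le> f u + 1" for f :: "nat \<Rightarrow> nat" and x y
    using potential_le_distance[of T V x y f] distance_le_diam[of H x y] TV conn that finite_V
    by (fastforce simp: H)
  let ?A = "{1..l}" and ?B = "{Suc l..l + m}"
  have arcs: "x = 0 \<and> y \<in> {1..s} \<or> x \<in> {1..s} \<and> y = 0 \<or> x = 0 \<and> y \<in> ?B \<or> x \<in> ?B \<and> y = 0 \<or>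
      (x, y) \<in> rim 1 l \<and> x \<in> ?A \<and> y \<in> ?A \<or> x \<in> ?B \<and> y \<in> ?B" if "(x, y) \<in> T" for x y
    using that T(1) rim_subset[of 1 l] rim_subset[of "Suc l" "l + m"] unfolding R_def wheel_def by blast
  have one_way: "(y, x) \<notin> T" if "(x, y) \<in> T" for x y
    using that T(3) by blast
  have hub_in_V: "0 \<in> V" and no_loop: "(0, 0) \<notin> T"
    using one_way by (simp add: V_def, blast)
  have spoke: "(0, a) \<in> T \<or> (a, 0) \<in> T" if "a \<in> {1..s}" for a
    using that subsetD[OF T(2), of "(0, a)"] by (auto simp: R_def wheel_iff)
  have leave: "\<exists>x\<in>X. (x, 0) \<in> T" and enter: "\<exists>x\<in>X. (0, x) \<in> T"
    if X: "X = ?A \<or> X = ?B" "x \<in> X" for X x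
  proof -
    have X': "y = 0 \<or> y \<in> X" "x = 0 \<or> x \<in> X" if "(x, y) \<in> T" "x \<in> X \<or> y \<in> X" for x y
      using arcs[OF that(1)] that(2) X(1) s_le_l by auto
    have "x \<in> V" "0 \<in> V" "0 \<notin> X"
      using X by (auto simp: V_def)
    then have "(x, 0) \<in> T\<^sup>*" "(0, x) \<in> T\<^sup>*"
      using conn by blast+
    then show "\<exists>x\<in>X. (x, 0) \<in> T" "\<exists>x\<in>X. (0, x) \<in> T"
      using rtrancl_leaves_set[of x 0 T X] rtrancl_leaves_set[of 0 x T "- X"] X(2) \<open>0 \<notin> X\<close> X'
      by blast+
  qed
  define k :: nat where "k = (if m = 0 then 0 else 2)"
  define ins outs where "ins = {a \<in> {1..s}. (a, 0) \<in> T}" and "outs = {a \<in> {1..s}. (0, a) \<in> T}"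
  have "ins \<union> outs = {1..s}"
    using spoke unfolding ins_def outs_def by blast
  moreover have "ins \<inter> outs = {}"
    using one_way unfolding ins_def outs_def by blast
  moreover have fin: "finite ins" "finite outs"
    by (simp_all add: ins_def outs_def)
  ultimately have "card ins + card outs \<le> 3"
    using s_le_3 card_Un_disjoint[of ins outs] by simp
  moreover have "ins \<noteq> {}" "outs \<noteq> {}"
  proof -
    obtain a a' where "a \<in> ?A" "(a, 0) \<in> T" "a' \<in> ?A" "(0, a') \<in> T"
      using leave[of ?A 1] enter[of ?A 1] s_le_l two_le_s by auto
    moreover from this have "a \<in> {1..s}" "a' \<in> {1..s}"
      using arcs[of a 0] arcs[of 0 a'] by auto
    ultimately show "ins \<noteq> {}" "outs \<noteq> {}"
      unfolding ins_def outs_def by blast+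
  qed
  then have "0 < card ins" "0 < card outs"
    using fin by (simp_all add: card_gt_0_iff)
  ultimately have "card outs = 1 \<or> card ins = 1"
    by linarith
  then consider j where "outs = {j}" | i where "ins = {i}"
    by (elim disjE card_1_singletonE)
  then show ?thesis
  proof cases
    case 1
    then have "j \<in> {1..s}"
      unfolding outs_def by blast
    then have j: "j \<in> ?A" "\<And>a. a \<in> {1..s} \<Longrightarrow> (0, a) \<in> T \<Longrightarrow> a = j"
      using s_le_l 1 unfolding outs_def by (simp, blast)
    obtain b where b: "b \<in> V" "b \<notin> ?A" "(b, 0) \<notin> T" "b = 0 \<longleftrightarrow> m = 0"
    proof (cases "m = 0")
      case True
      then show thesis
        using that[of 0] hub_in_V no_loop by simp
    next
      case False
      then obtain b where "b \<in> ?B" "(0, b) \<in> T"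
        using enter[of ?B "Suc l"] by auto
      then show thesis
        using that[of b] one_way[of 0 b] False by (auto simp: V_def)
    qed
    (* the predecessor of j on the rim, which is reached last *)
    define z where "z = (if j = 1 then l else j - 1)"
    have z: "z \<in> ?A" "rim_dist l j z = l - 1"
      using j(1) by (auto simp: z_def rim_dist_def)
    define f where "f v = (if v = b then 0 else if v = 0 then k else if v \<in> ?B then 1
        else k + 1 + rim_dist l j v)" for v
    have f: "f 0 = k" "f b = 0" "\<And>v. v \<in> ?B \<Longrightarrow> v \<noteq> b \<Longrightarrow> f v = 1"
      "\<And>v. v \<in> ?A \<Longrightarrow> f v = k + 1 + rim_dist l j v"
      using b by (auto simp: f_def k_def)
    have f_B: "f v \<le> 1" if "v \<in> ?B" for v
      using f(2,3) that by (cases "v = b") auto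
    have "f v \<le> f u + 1" if uv: "(u, v) \<in> T" for u v
      using arcs[OF uv]
    proof (elim disjE conjE)
      assume "u = 0" "v \<in> {1..s}"
      then show ?thesis
        using j uv f by simp
    next
      assume "u \<in> {1..s}" "v = 0"
      then show ?thesis
        using f s_le_l by simp
    next
      assume "u \<in> ?B" "v = 0"
      then show ?thesis
        using f b(3) uv by (cases "u = b") (auto simp: k_def)
    next
      assume "(u, v) \<in> rim 1 l" "u \<in> ?A" "v \<in> ?A"
      then show ?thesis
        using f rim_dist_step[of u v l j] j(1) by simp
    qed (use f_B[of v] in auto)
    then have "f z \<le> f b + diam H"
      using b(1) z(1) by (intro bound) (auto simp: V_def)
    then show ?thesis
      using f(2) f(4)[OF z(1)] z by (simp add: k_def)
  next
    case 2
    then have "i \<in> {1..s}"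
      unfolding ins_def by blast
    then have i: "i \<in> ?A" "\<And>a. a \<in> {1..s} \<Longrightarrow> (a, 0) \<in> T \<Longrightarrow> a = i"
      using s_le_l 2 unfolding ins_def by (simp, blast)
    obtain b where b: "b \<in> V" "b \<notin> ?A" "(0, b) \<notin> T" "b = 0 \<longleftrightarrow> m = 0"
    proof (cases "m = 0")
      case True
      then show thesis
        using that[of 0] hub_in_V no_loop by simp
    next
      case False
      then obtain b where "b \<in> ?B" "(b, 0) \<in> T"
        using leave[of ?B "Suc l"] by auto
      then show thesis
        using that[of b] one_way[of b 0] False by (auto simp: V_def)
    qed
    (* the successor of i on the rim, which has the longest way to the hub *)
    define z where "z = (if i = l then 1 else i + 1)"
    have z: "z \<in> ?A" "rim_dist l z i = l - 1"
      using i(1) by (auto simp: z_def rim_dist_def)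
    define f where "f v = (if v \<in> ?A then rim_dist l z v else if v = b then l + k
        else if v = 0 then l else l + 1)" for v
    have f: "f 0 = l" "f b = l + k" "\<And>v. v \<in> ?B \<Longrightarrow> v \<noteq> b \<Longrightarrow> f v = l + 1"
      "\<And>v. v \<in> ?A \<Longrightarrow> f v = rim_dist l z v"
      using b by (auto simp: f_def k_def)
    have f_B: "l + 1 \<le> f v" "f v \<le> l + 2" if "v \<in> ?B" for v
      using f(2,3) that b(4) by (cases "v = b"; auto simp: k_def)+
    have "f v \<le> f u + 1" if uv: "(u, v) \<in> T" for u v
      using arcs[OF uv]
    proof (elim disjE conjE)
      assume "u = 0" "v \<in> {1..s}"
      then show ?thesis
        using f(1) f(4)[of v] rim_dist_le[OF z(1), of v] s_le_l by simp
    next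
      assume "u \<in> {1..s}" "v = 0"
      then show ?thesis
        using f i uv z by simp
    next
      assume "u = 0" "v \<in> ?B"
      then show ?thesis
        using f b(3) uv by (cases "v = b") auto
    next
      assume "(u, v) \<in> rim 1 l" "u \<in> ?A" "v \<in> ?A"
      then show ?thesis
        using f rim_dist_step[of u v l z] z(1) by simp
    qed (use f f_B[of u] f_B[of v] in auto)
    then have "f b \<le> f z + diam H"
      using b(1) z(1) by (intro bound) (auto simp: V_def)
    then show ?thesis
      using f(2) f(4)[OF z(1)] by (simp add: k_def)
  qed
qed

lemma oriented_diameter_ge:
  "l + (if m = 0 then 0 else 2) \<le> oriented_diameter (mixed_graph_of V R)"
  unfolding oriented_diameter_def using ex_strong_orientation diam_ge by (intro cInf_greatest) auto

end

lemma ex_trivial_graph: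
  "\<exists>G :: nat mixed_graph. mixed_graph G \<and> bridgeless G \<and> card (mverts G) = 1 \<and>
     max_und_degree G = 0 \<and> (\<exists>u\<in>mverts G. und_degree G u = 0 \<and> out_deg G u + in_deg G u = 0)"
proof (intro exI conjI)
  let ?G = "mixed_graph_of {0 :: nat} {}"
  have no_edges: "medges ?G = {}"
    by (simp add: mixed_graph_of_def)
  have "mixed_connected ?G"
    by (rule mixed_connected_if_hub_connected[of 0]) (simp_all add: hub_connected_def)
  then show "bridgeless ?G"
    by (simp add: bridgeless_def bridge_def no_edges)
qed (simp_all add: mixed_graph_mixed_graph_of max_und_degree_def und_degree_mixed_graph_of
    out_deg_def in_deg_def irrefl_def)

theorem theorem3p2:
  fixes n \<Delta> :: nat
  assumes "\<Delta> < n"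
    and "n = 1 \<or> 2 \<le> \<Delta>"
  shows "\<exists>G :: nat mixed_graph.
           mixed_graph G \<and> bridgeless G \<and> card (mverts G) = n \<and> max_und_degree G = \<Delta> \<and>
           (\<exists>u\<in>mverts G. und_degree G u = \<Delta> \<and> out_deg G u + in_deg G u = 0) \<and>
           oriented_diameter G \<ge> min (n - 1) (n - \<Delta> + 4)"
proof (cases "n = 1")
  case True
  then show ?thesis
    using ex_trivial_graph assms(1) by simp
next
  case False
  (* Two spokes in the long block when Delta is 2 or 4: with three spokes the short block would need -1
     or 1 vertices. *)
  define s m where "s = (if \<Delta> = 2 \<or> \<Delta> = 4 then 2 else 3 :: nat)" and "m = \<Delta> - s"
  define l where "l = n - 1 - m"
  have size: "l + m = n - 1" "s + m = \<Delta>"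
    using assms False by (auto simp: s_def m_def l_def)
  interpret two_wheels l s m
    using assms False by unfold_locales (auto simp: s_def m_def l_def)
  have "min (n - 1) (n - \<Delta> + 4) \<le> l + (if m = 0 then 0 else 2)"
    using assms False by (auto simp: s_def m_def l_def)
  then have "min (n - 1) (n - \<Delta> + 4) \<le> oriented_diameter (mixed_graph_of V R)"
    using oriented_diameter_ge by linarith
  moreover have "0 \<in> V" "card V = n"
    using assms(1) size by (simp_all add: V_def)
  ultimately show ?thesis
    using mixed_graph bridgeless max_und_degree und_degree_hub no_arcs_at_hub size(2)
    by (intro exI[of _ "mixed_graph_of V R"]) auto
qed

end
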